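(* Let $n$ be a positive integer. In every complete play of the Zeckendorf game starting from $\{F_1^n\}$, the number of moves is at most $3n - 3Z(n) - IZ(n) + 1$; that is, the longest game on $n$ has at most $3n-3Z(n)-IZ(n)+1$ moves. Moreover, the number of moves in every complete play is at least $n - Z(n)$, and consequently each game takes order $n$ moves: there exist absolute constants $0<c<C$ such that, for all sufficiently large $n$, every complete play on $n$ has between $cn$ and $Cn$ moves.
   Context: Fibonacci numbers are normalized by $F_1 = 1$, $F_2 = 2$, $F_{i+1} = F_i + F_{i-1}$ for $i\ge 2$. By Zeckendorf's theorem every positive integer $n$ has a unique representation (its Zeckendorf decomposition) as a sum of distinct, non-adjacent Fibonacci numbers $F_i$, $i \ge 1$ (no two indices equal or consecutive). $Z(n)$ is the number of terms in the Zeckendorf decomposition of $n$, and $IZ(n)$ is the sum of the indices $i$ of the terms $F_i$ in that decomposition. The Zeckendorf game on $n$: a state is an unordered list (multiset) of Fibonacci numbers, recorded by their indices, with sum $n$. The initial state is $\{F_1^n\}$, i.e. $n$ copies of $F_1$. The two players alternate; on each turn one of the following moves is made: (1) if the list contains two consecutive Fibonacci numbers $F_{i-1}, F_i$ (with $i\ge 2$), replace one copy of each by one $F_{i+1}$; (2) if the list contains two copies of the same Fibonacci number $F_i$, then: (a) if $i=1$, replace $F_1, F_1$ by $F_2$; (b) if $i=2$, replace $F_2,F_2$ by $F_1,F_3$; (c) if $i\ge 3$, replace $F_i,F_i$ by $F_{i-2},F_{i+1}$. The game ends when the list is the Zeckendorf decomposition of $n$. A complete play is a sequence of legal moves from the initial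 state to the end of the game; its number of moves is the total number of moves made by both players. *)

theory Defs
  imports "HOL-Number_Theory.Fib" "HOL-Library.Multiset"
begin

text \<open>
  The library's \<^const>\<open>fib\<close> satisfies \<open>fib 1 = fib 2 = 1\<close>; here the normalization is
  \<open>F\<^sub>1 = 1\<close>, \<open>F\<^sub>2 = 2\<close>, hence the shift of the index by one.
\<close>

definition F :: "nat \<Rightarrow> nat" where
  "F i = fib (Suc i)"

lemma F_1: "F 1 = 1"
  and F_2: "F 2 = 2"
  and F_rec: "i \<ge> 2 \<Longrightarrow> F (i + 1) = F i + F (i - 1)"
  by (auto simp: F_def numeral_2_eq_2 Suc_le_eq gr0_conv_Suc elim!: less_natE)

definition is_zeckendorf :: "nat \<Rightarrow> nat set \<Rightarrow> bool" where
  "is_zeckendorf n S \<longleftrightarrow>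
     finite S \<and> (\<forall>i\<in>S. i \<ge> 1) \<and> (\<forall>i\<in>S. i + 1 \<notin> S) \<and> (\<Sum>i\<in>S. F i) = n"

text \<open>The description operator is meaningful by Zeckendorf's theorem.\<close>

definition zeckendorf :: "nat \<Rightarrow> nat set" where
  "zeckendorf n = (THE S. is_zeckendorf n S)"

definition Z :: "nat \<Rightarrow> nat" where
  "Z n = card (zeckendorf n)"

definition IZ :: "nat \<Rightarrow> nat" where
  "IZ n = \<Sum>(zeckendorf n)"

text \<open>A state is the multiset of the indices of the Fibonacci numbers in the list.\<close>

inductive zmove :: "nat multiset \<Rightarrow> nat multiset \<Rightarrow> bool" where
  consecutive: "i \<ge> 2 \<Longrightarrow> zmove (M + {#i - 1, i#}) (M + {#i + 1#})"
| double_1: "zmove (M + {#1, 1#}) (M + {#2#})"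
| double_2: "zmove (M + {#2, 2#}) (M + {#1, 3#})"
| double: "i \<ge> 3 \<Longrightarrow> zmove (M + {#i, i#}) (M + {#i - 2, i + 1#})"

text \<open>
  A complete play is given by the list of all states it passes through, so it has one move fewer
  than states. It need not be required that the Zeckendorf decomposition is not reached before the
  last state, because no move is possible there (lemma \<open>is_zeckendorf_no_move\<close>).
\<close>

definition complete_play :: "nat \<Rightarrow> nat multiset list \<Rightarrow> bool" where
  "complete_play n ss \<longleftrightarrow>
     ss \<noteq> [] \<and> hd ss = replicate_mset n 1 \<and> last ss = mset_set (zeckendorf n) \<and>
     (\<forall>k. k + 1 < length ss \<longrightarrow> zmove (ss ! k) (ss ! (k + 1)))"

definition num_moves :: "nat multiset list \<Rightarrow> nat" where
  "num_moves ss = length ss - 1"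

lemma is_zeckendorf_no_move:
  assumes "is_zeckendorf n S"
  shows "\<not> zmove (mset_set S) N"
proof
  assume "zmove (mset_set S) N"
  moreover have fin: "finite S" and gap: "\<And>i. i \<in> S \<Longrightarrow> i + 1 \<notin> S"
    using assms by (auto simp: is_zeckendorf_def)
  have no_double: False if "mset_set S = M + {#i, i#}" for M i
  proof -
    have "count (mset_set S) i \<ge> 2" unfolding that by simp
    then show False using fin by (cases "i \<in> S") auto
  qed
  ultimately show False
  proof cases
    case (consecutive i M)
    then have "i - 1 \<in># mset_set S" "i \<in># mset_set S" by simp_all
    then have "i - 1 \<in> S" "i \<in> S" using fin by (simp_all del: One_nat_def)
    with gap[of "i - 1"] consecutive show False by simp
  qed (use no_double in blast)+
qed

end

theory Submission
  imports Defs
begin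

text \<open>
  A merging move (\<open>F\<^sub>1, F\<^sub>1\<close> or two consecutive terms) removes one term from the list and a
  splitting move keeps their number, so at least \<open>n - Z n\<close> moves are needed. For the upper bound,
  give every term \<open>F\<^sub>i\<close> the weight \<open>(3 + 3 i + [i = 2]) / 2\<close>. This combines the number of terms, the
  sum of the indices, which every splitting move but that of \<open>F\<^sub>2, F\<^sub>2\<close> lowers by one, and the number
  of terms \<open>F\<^sub>2\<close>, which the splitting of \<open>F\<^sub>2, F\<^sub>2\<close> lowers by two. Every move lowers the total weight
  by at least one.
\<close>

definition weight2 :: "nat \<Rightarrow> int" where
  \<comment> \<open>twice the weight, to stay within the integers\<close>
  "weight2 i = 3 + 3 * int i + of_bool (i = 2)"

text \<open>The loss is exactly 2 when the doubled index is 1, 2 or 4. At 4, the index sum falls by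
  1, worth 3, but the new term of index 2 takes back 1.\<close>

lemma zmove_weight2:
  assumes "zmove M N"
  shows "(\<Sum>i\<in>#M. weight2 i) \<ge> (\<Sum>i\<in>#N. weight2 i) + 2"
  using assms by cases (auto simp: weight2_def of_nat_diff)

lemma zmove_size:
  assumes "zmove M N"
  shows "size M \<le> size N + 1"
  using assms by cases auto

lemma zmove_sum_F:
  assumes "zmove M N"
  shows "(\<Sum>i\<in>#N. F i) = (\<Sum>i\<in>#M. F i)"
  using assms
proof cases
  case (consecutive i K)
  then show ?thesis using F_rec[of i] by simp
next
  case (double i K)
  then have "F (i + 1) = F i + F (i - 1)" "F i = F (i - 1) + F (i - 2)"
    using F_rec[of i] F_rec[of "i - 1"] by (simp_all add: numeral_2_eq_2 Suc_diff_Suc)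
  with double show ?thesis by simp
qed (simp_all add: F_def numeral_2_eq_2 numeral_3_eq_3)

text \<open>This and the invariance of the sum pass along a play from its first list to its last.
  Thus the needed facts about \<open>zeckendorf n\<close>, given only by \<open>THE\<close>, are
  read off the play itself.\<close>

lemma zmove_index_pos:
  assumes "zmove M N" "0 \<notin># M"
  shows "0 \<notin># N"
  using assms by cases auto

lemma zmoves_weight2:
  assumes "(zmove ^^ k) M N"
  shows "(\<Sum>i\<in>#M. weight2 i) \<ge> (\<Sum>i\<in>#N. weight2 i) + 2 * int k"
  using assms
proof (induction k arbitrary: N)
  case (Suc k)
  then obtain K where "(zmove ^^ k) M K" "zmove K N" by auto
  then show ?case using Suc.IH[of K] zmove_weight2[of K N] by simp
qed simp

lemma zmoves_size:
  assumes "(zmove ^^ k) M N"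
  shows "size M \<le> size N + k"
  using assms
proof (induction k arbitrary: N)
  case (Suc k)
  then obtain K where "(zmove ^^ k) M K" "zmove K N" by auto
  then show ?case using Suc.IH[of K] zmove_size[of K N] by simp
qed simp

lemma zmoves_sum_F:
  assumes "(zmove ^^ k) M N"
  shows "(\<Sum>i\<in>#N. F i) = (\<Sum>i\<in>#M. F i)"
  using assms by (induction k arbitrary: N) (auto simp: zmove_sum_F)

lemma zmoves_index_pos:
  assumes "(zmove ^^ k) M N" "0 \<notin># M"
  shows "0 \<notin># N"
  using assms by (induction k arbitrary: N) (auto dest: zmove_index_pos)

lemma complete_play_zmoves:
  assumes "complete_play n ss"
  shows "(zmove ^^ num_moves ss) (replicate_mset n 1) (mset_set (zeckendorf n))"
  using assms unfolding complete_play_def relpowp_fun_conv num_moves_def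
  by (intro exI[of _ "nth ss"]) (auto simp: hd_conv_nth last_conv_nth)

lemma sum_of_bool_eq_le_1: "(\<Sum>i\<in>S. of_bool (i = a)) \<le> (1 :: 'b :: linordered_semidom)"
  by (cases "finite S") (auto simp: of_bool_def)

text \<open>An index of at least 3 pays for its own 3. Index 2 falls short by 1, which the bonus
  covers; index 1 falls short by 2, and it occurs at most once.\<close>

lemma card_le_sum_indices:
  assumes "0 \<notin> S"
  shows "3 * int (card S) \<le> int (\<Sum>S) + (\<Sum>i\<in>S. of_bool (i = 2)) + 2"
proof -
  have "3 \<le> int i + of_bool (i = 2) + 2 * of_bool (i = 1)" if "i \<in> S" for i
  proof -
    have "i \<noteq> 0" using assms that by metis
    then show ?thesis by (auto simp: of_bool_def)
  qed
  moreover have "3 * int (card S) = (\<Sum>i\<in>S. 3)" by simp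
  ultimately have "3 * int (card S) \<le> (\<Sum>i\<in>S. int i + of_bool (i = 2) + 2 * of_bool (i = 1))"
    by (metis (no_types, lifting) sum_mono)
  also have "\<dots> = int (\<Sum>S) + (\<Sum>i\<in>S. of_bool (i = 2)) + 2 * (\<Sum>i\<in>S. of_bool (i = 1))"
    by (simp add: sum.distrib sum_distrib_left)
  also have "\<dots> \<le> int (\<Sum>S) + (\<Sum>i\<in>S. of_bool (i = 2)) + 2"
    using sum_of_bool_eq_le_1[of 1 S, where 'b = int] by simp
  finally show ?thesis .
qed

lemma F_ge_2:
  assumes "i \<ge> 2"
  shows "F i \<ge> 2"
  using fib_mono[of 3 "Suc i"] assms by (simp add: F_def numeral_3_eq_3)

text \<open>Only \<open>F 1 = 1\<close> is below 2. The resulting bound on \<open>Z n\<close> turns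
  \<open>n - Z n\<close> into a linear lower bound.\<close>

lemma card_le_sum_F:
  assumes "0 \<notin> S"
  shows "2 * card S \<le> (\<Sum>i\<in>S. F i) + 1"
proof -
  have "2 \<le> F i + of_bool (i = 1)" if "i \<in> S" for i
  proof (cases "i = 1")
    case False
    moreover have "i \<noteq> 0" using assms that by metis
    ultimately show ?thesis using F_ge_2[of i] by simp
  qed (simp add: F_def)
  then have "(\<Sum>i\<in>S. 2) \<le> (\<Sum>i\<in>S. F i + of_bool (i = 1))" by (intro sum_mono)
  then show ?thesis
    using sum_of_bool_eq_le_1[of 1 S, where 'b = nat] by (simp add: sum.distrib)
qed

lemma complete_play_bounds:
  assumes "complete_play n ss"
  shows "int (num_moves ss) \<le> 3 * int n - 3 * int (Z n) - int (IZ n) + 1"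
    and "n \<le> Z n + num_moves ss"
    and "2 * Z n \<le> n + 1"
proof -
  define S where "S = zeckendorf n"
  have moves: "(zmove ^^ num_moves ss) (replicate_mset n 1) (mset_set S)"
    using complete_play_zmoves[OF assms] by (simp add: S_def)
  \<comment> \<open>An infinite \<open>S\<close> need not be excluded: then \<open>mset_set S\<close>, \<open>card S\<close> and all sums over \<open>S\<close>
      vanish.\<close>
  have pos: "0 \<notin> S \<or> infinite S"
    using zmoves_index_pos[OF moves] by (cases "n = 0") auto
  show "n \<le> Z n + num_moves ss"
    using zmoves_size[OF moves] by (simp add: Z_def S_def)
  have "(\<Sum>i\<in>S. F i) = n"
    using zmoves_sum_F[OF moves] by (simp add: sum_unfold_sum_mset F_def)
  then show "2 * Z n \<le> n + 1"
    using card_le_sum_F[of S] pos by (auto simp: Z_def S_def)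
  \<comment> \<open>Each of the \<open>n\<close> initial terms has
    \<open>weight2 1 = 6\<close>.\<close>
  have "2 * int (num_moves ss) + (\<Sum>i\<in>S. weight2 i) \<le> 6 * int n"
    using zmoves_weight2[OF moves] by (simp add: sum_unfold_sum_mset weight2_def)
  moreover have "(\<Sum>i\<in>S. weight2 i) = 3 * int (Z n) + 3 * int (IZ n) + (\<Sum>i\<in>S. of_bool (i = 2))"
    by (simp add: weight2_def sum.distrib sum_distrib_left Z_def IZ_def S_def)
  moreover have "3 * int (Z n) \<le> int (IZ n) + (\<Sum>i\<in>S. of_bool (i = 2)) + 2"
    using card_le_sum_indices[of S] pos by (auto simp: Z_def IZ_def S_def)
  \<comment> \<open>Adding the inequalities cancels the bonus for index 2 and gives twice the claim;
    the constant 2 becomes the final 1.\<close>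
  ultimately show "int (num_moves ss) \<le> 3 * int n - 3 * int (Z n) - int (IZ n) + 1"
    by linarith
qed

theorem theorem1p2:
  shows "(\<forall>n\<ge>1. \<forall>ss. complete_play n ss \<longrightarrow>
            int (num_moves ss) \<le> 3 * int n - 3 * int (Z n) - int (IZ n) + 1 \<and>
            int (num_moves ss) \<ge> int n - int (Z n)) \<and>
         (\<exists>c C :: real. 0 < c \<and> c < C \<and>
            (\<forall>\<^sub>F n in sequentially. \<forall>ss. complete_play n ss \<longrightarrow>
               c * real n \<le> real (num_moves ss) \<and> real (num_moves ss) \<le> C * real n))"
proof (intro conjI)
  show "\<forall>n\<ge>1. \<forall>ss. complete_play n ss \<longrightarrow>
            int (num_moves ss) \<le> 3 * int n - 3 * int (Z n) - int (IZ n) + 1 \<and>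
            int (num_moves ss) \<ge> int n - int (Z n)"
    using complete_play_bounds by fastforce
  \<comment> \<open>For \<open>n \<ge> 2\<close>, \<open>n - Z n\<close> is at least
    \<open>(n - 1) / 2\<close>, hence at least \<open>n / 4\<close>, and \<open>3 * n + 1\<close> is
    at most \<open>4 * n\<close>.\<close>
  have "1 / 4 * real n \<le> real (num_moves ss) \<and> real (num_moves ss) \<le> 4 * real n"
    if "n \<ge> 2" "complete_play n ss" for n ss
    using complete_play_bounds[OF that(2)] that(1) by linarith
  then show "\<exists>c C :: real. 0 < c \<and> c < C \<and>
            (\<forall>\<^sub>F n in sequentially. \<forall>ss. complete_play n ss \<longrightarrow>
               c * real n \<le> real (num_moves ss) \<and> real (num_moves ss) \<le> C * real n)"
    by (intro exI[of _ "1 / 4"] exI[of _ 4] conjI eventually_sequentiallyI[of 2]) auto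
qed

end
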